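(* Let $\mathcal F$ be an eigenfamily of homogeneous degree $2$ polynomial harmonic morphisms $\mathbb{R}^m\to\mathbb{C}$. Then $\mathcal F$ admits a uniform axis of holomorphy of real dimension at least $\min(2,m)$.
   Context: Polynomials $\mathbb{R}^m\to\mathbb{C}$ are polynomials in the real coordinates with complex coefficients. For polynomials, "eigenfamily" means $(0,0)$-eigenfamily: a family $\mathcal F$ of smooth functions $\mathbb{R}^m\to\mathbb{C}$ such that for all $F,G\in\mathcal F$ and all $x$: $\Delta F=0$ and $(\nabla_xF)^T\nabla_xG=0$, where $\nabla_xF=\nabla_x\operatorname{Re}F+i\nabla_x\operatorname{Im}F\in\mathbb{C}^m$ and $v^Tw=\sum_jv_jw_j$ (no conjugation). A map $F:\mathbb{R}^m\to\mathbb{C}$ is a harmonic morphism iff $\Delta F=0$ and $(\nabla_xF)^T\nabla_xF=0$ for all $x$ (so elements of an eigenfamily are automatically harmonic morphisms). For a Euclidean vector space $V$, a family $\mathcal F$ of functions $V\to\mathbb{C}$ is uniformly of complex type if there are $k\geq 0$, an orthogonal projection $\pi:V\to\mathbb{C}^k$ (i.e. the adjoint of an isometric $\mathbb{R}$-linear embedding $\mathbb{C}^k\cong\mathbb{R}^{2k}\to V$), and a family $\mathcal G$ of holomorphic maps $\mathbb{C}^k\to\mathbb{C}$ with $\mathcal F=\{G\circ\pi\mid G\in\mathcal G\}$. A vector subspace $V\subseteq\mathbb{R}^m$ is a uniform axis of holomorphy of a family $\mathcal F$ of functions $\mathbb{R}^m\to\mathbb{C}$ if the family $\{V\to\mathbb{C},\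 v\mapsto F(x+v)\mid x\in\mathbb{R}^m,F\in\mathcal F\}$ is uniformly of complex type. *)

theory Defs
  imports "HOL-Analysis.Analysis"
begin

definition partial_deriv ::
    "'n::finite \<Rightarrow> (real^'n \<Rightarrow> 'b::real_normed_vector) \<Rightarrow> real^'n \<Rightarrow> 'b" where
  "partial_deriv j f x = frechet_derivative f (at x) (axis j 1)"

text \<open>The predicate \<open>Ck_map k f\<close> says that \<open>f\<close> is of class $C^k$ on the whole space.\<close>

fun Ck_map :: "nat \<Rightarrow> (real^'n::finite \<Rightarrow> 'b::real_normed_vector) \<Rightarrow> bool" where
  "Ck_map 0 f \<longleftrightarrow> continuous_on UNIV f"
| "Ck_map (Suc k) f \<longleftrightarrow> f differentiable_on UNIV \<and> (\<forall>j. Ck_map k (partial_deriv j f))"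

definition smooth_map :: "(real^'n::finite \<Rightarrow> 'b::real_normed_vector) \<Rightarrow> bool" where
  "smooth_map f \<longleftrightarrow> (\<forall>k. Ck_map k f)"

definition laplacian :: "(real^'n::finite \<Rightarrow> 'b::real_normed_vector) \<Rightarrow> real^'n \<Rightarrow> 'b" where
  "laplacian f x = (\<Sum>j\<in>UNIV. partial_deriv j (partial_deriv j f) x)"

definition gradient :: "(real^'n::finite \<Rightarrow> real) \<Rightarrow> real^'n \<Rightarrow> real^'n" where
  "gradient f x = (\<chi> j. partial_deriv j f x)"

definition cgradient :: "(real^'n::finite \<Rightarrow> complex) \<Rightarrow> real^'n \<Rightarrow> complex^'n" where
  "cgradient F x = (\<chi> j. complex_of_real (gradient (\<lambda>y. Re (F y)) x $ j)
                        + \<i> * complex_of_real (gradient (\<lambda>y. Im (F y)) x $ j))"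

text \<open>The complex bilinear product $v^T w$, without conjugation (unlike \<open>inner\<close> on
  \<open>complex^'n\<close>, which is the real inner product).\<close>

definition bilinear_dot :: "complex^'n::finite \<Rightarrow> complex^'n \<Rightarrow> complex" where
  "bilinear_dot v w = (\<Sum>j\<in>UNIV. v $ j * w $ j)"

definition eigenfamily :: "(real^'n::finite \<Rightarrow> complex) set \<Rightarrow> bool" where
  "eigenfamily \<F> \<longleftrightarrow>
     (\<forall>F\<in>\<F>. smooth_map F) \<and>
     (\<forall>F\<in>\<F>. \<forall>G\<in>\<F>. \<forall>x.
        laplacian F x = 0 \<and> bilinear_dot (cgradient F x) (cgradient G x) = 0)"

definition harmonic_morphism :: "(real^'n::finite \<Rightarrow> complex) \<Rightarrow> bool" where
  "harmonic_morphism F \<longleftrightarrow>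
     smooth_map F \<and>
     (\<forall>x. laplacian F x = 0 \<and> bilinear_dot (cgradient F x) (cgradient F x) = 0)"

text \<open>Homogeneous polynomials of degree \<open>d\<close> in the real coordinates with complex coefficients
  \<open>c \<alpha>\<close>, indexed by the multi-indices \<open>\<alpha>\<close> with $|\alpha| = d$. The zero
  polynomial is homogeneous of every degree.\<close>

definition homogeneous_poly :: "nat \<Rightarrow> (real^'n::finite \<Rightarrow> complex) \<Rightarrow> bool" where
  "homogeneous_poly d F \<longleftrightarrow>
     (\<exists>c :: ('n \<Rightarrow> nat) \<Rightarrow> complex. \<forall>x.
        F x = (\<Sum>\<alpha> | (\<Sum>i\<in>UNIV. \<alpha> i) = d.
                 c \<alpha> * (\<Prod>i\<in>UNIV. complex_of_real (x $ i) ^ \<alpha> i)))"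

lemma finite_multi_indices: "finite {\<alpha> :: 'n::finite \<Rightarrow> nat. (\<Sum>i\<in>UNIV. \<alpha> i) = d}"
proof (rule finite_subset)
  show "{\<alpha> :: 'n \<Rightarrow> nat. (\<Sum>i\<in>UNIV. \<alpha> i) = d} \<subseteq> (UNIV \<rightarrow>\<^sub>E {..d})"
    by (auto simp: PiE_def Pi_def intro: member_le_sum)
  show "finite (UNIV \<rightarrow>\<^sub>E {..d} :: ('n \<Rightarrow> nat) set)"
    by (intro finite_PiE) auto
qed

text \<open>Since \<open>k\<close> is existentially quantified below, $\mathbb{C}^k$ is modelled by the sequences
  vanishing from index \<open>k\<close> on, with the Euclidean structure of
  $\mathbb{C}^k \cong \mathbb{R}^{2k}$; \<open>inner\<close> on \<open>complex\<close> is the real inner product.\<close>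

definition cspace :: "nat \<Rightarrow> (nat \<Rightarrow> complex) set" where
  "cspace k = {z. \<forall>i\<ge>k. z i = 0}"

definition cspace_inner :: "nat \<Rightarrow> (nat \<Rightarrow> complex) \<Rightarrow> (nat \<Rightarrow> complex) \<Rightarrow> real" where
  "cspace_inner k z w = (\<Sum>i<k. inner (z i) (w i))"

definition cspace_norm :: "nat \<Rightarrow> (nat \<Rightarrow> complex) \<Rightarrow> real" where
  "cspace_norm k z = L2_set (\<lambda>i. cmod (z i)) {..<k}"

text \<open>Complex Frechet differentiability at every point of $\mathbb{C}^k$; \<open>a\<close> is the vector of
  complex partial derivatives at \<open>z\<close>.\<close>

definition holomorphic_cspace :: "nat \<Rightarrow> ((nat \<Rightarrow> complex) \<Rightarrow> complex) \<Rightarrow> bool" where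
  "holomorphic_cspace k G \<longleftrightarrow>
     (\<forall>z\<in>cspace k. \<exists>a. \<forall>e>0. \<exists>d>0. \<forall>w\<in>cspace k.
        cspace_norm k (\<lambda>i. w i - z i) < d \<longrightarrow>
        cmod (G w - G z - (\<Sum>i<k. a i * (w i - z i))) \<le> e * cspace_norm k (\<lambda>i. w i - z i))"

definition isometric_embedding ::
    "nat \<Rightarrow> 'a::euclidean_space set \<Rightarrow> ((nat \<Rightarrow> complex) \<Rightarrow> 'a) \<Rightarrow> bool" where
  "isometric_embedding k V \<iota> \<longleftrightarrow>
     (\<forall>z\<in>cspace k. \<iota> z \<in> V) \<and>
     (\<forall>z\<in>cspace k. \<forall>w\<in>cspace k. \<iota> (\<lambda>i. z i + w i) = \<iota> z + \<iota> w) \<and>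
     (\<forall>t::real. \<forall>z\<in>cspace k. \<iota> (\<lambda>i. t *\<^sub>R z i) = t *\<^sub>R \<iota> z) \<and>
     (\<forall>z\<in>cspace k. norm (\<iota> z) = cspace_norm k z)"

definition orthogonal_projection ::
    "nat \<Rightarrow> 'a::euclidean_space set \<Rightarrow> ('a \<Rightarrow> (nat \<Rightarrow> complex)) \<Rightarrow> bool" where
  "orthogonal_projection k V \<pi> \<longleftrightarrow>
     (\<forall>v\<in>V. \<pi> v \<in> cspace k) \<and>
     (\<exists>\<iota>. isometric_embedding k V \<iota> \<and>
          (\<forall>v\<in>V. \<forall>z\<in>cspace k. cspace_inner k (\<pi> v) z = inner v (\<iota> z)))"

text \<open>Functions on the subspace \<open>V\<close> are represented by their \<^const>\<open>restrict\<close>ed versions, so that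
  equality of sets of such functions is equality of sets of functions on \<open>V\<close>.\<close>

definition uniformly_complex_type ::
    "'a::euclidean_space set \<Rightarrow> ('a \<Rightarrow> complex) set \<Rightarrow> bool" where
  "uniformly_complex_type V \<H> \<longleftrightarrow>
     (\<exists>k \<pi> \<G>. orthogonal_projection k V \<pi> \<and>
        (\<forall>G\<in>\<G>. holomorphic_cspace k G) \<and>
        \<H> = {(\<lambda>v\<in>V. G (\<pi> v)) | G. G \<in> \<G>})"

definition uniform_axis_of_holomorphy ::
    "'a::euclidean_space set \<Rightarrow> ('a \<Rightarrow> complex) set \<Rightarrow> bool" where
  "uniform_axis_of_holomorphy V \<F> \<longleftrightarrow>
     subspace V \<and>
     uniformly_complex_type V {(\<lambda>v\<in>V. F (x + v)) | x F. F \<in> \<F>}"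

end

theory Submission
  imports Defs
begin

text \<open>Write \<open>F\<close> as the quadratic form of a complex symmetric matrix \<open>A\<close>. The eigenfamily condition
  says that these matrices pairwise anticommute; in particular they square to zero. Up to sign, a
  product of such matrices is therefore symmetric and commutes with each of them, and a product of
  elements of a finite spanning set that is nonzero and as long as possible is a matrix \<open>P\<close> killed
  by every \<open>A\<close>. Unless all \<open>A\<close> vanish, $P^T P = \pm P^2 = 0$, so a nonzero column
  \<open>w = a + \<i>b\<close> of \<open>P\<close> is isotropic: \<open>a\<close>, \<open>b\<close> are orthogonal of equal length. From \<open>A w = 0\<close> the
  restriction of every \<open>A\<close> to the plane spanned by \<open>a\<close>, \<open>b\<close> is complex linear.\<close>

section \<open>Quadratic forms\<close>

definition cvec :: "real^'n::finite \<Rightarrow> complex^'n" where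
  "cvec x = (\<chi> i. complex_of_real (x $ i))"

lemma cvec_add: "cvec (x + y) = cvec x + cvec y"
  by (simp add: cvec_def vec_eq_iff)

lemma cvec_scaleR: "cvec (t *\<^sub>R x) = complex_of_real t *s cvec x"
  by (simp add: cvec_def vec_eq_iff)

lemma bilinear_dot_commute: "bilinear_dot v w = bilinear_dot w v"
  by (simp add: bilinear_dot_def mult.commute)

lemma bilinear_dot_add_left: "bilinear_dot (u + v) w = bilinear_dot u w + bilinear_dot v w"
  by (simp add: bilinear_dot_def sum.distrib distrib_right)

lemma bilinear_dot_add_right: "bilinear_dot u (v + w) = bilinear_dot u v + bilinear_dot u w"
  by (simp add: bilinear_dot_def sum.distrib distrib_left)

lemma bilinear_dot_scale_left: "bilinear_dot (c *s v) w = c * bilinear_dot v w"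
  by (simp add: bilinear_dot_def sum_distrib_left mult_ac)

lemma bilinear_dot_scale_right: "bilinear_dot v (c *s w) = c * bilinear_dot v w"
  by (simp add: bilinear_dot_def sum_distrib_left mult_ac)

lemma bilinear_dot_matrix:
  "bilinear_dot (A *v v) w = bilinear_dot v (transpose A *v w)"
proof -
  have "bilinear_dot (A *v v) w = (\<Sum>i\<in>UNIV. \<Sum>j\<in>UNIV. v $ j * (A $ i $ j * w $ i))"
    by (simp add: bilinear_dot_def matrix_vector_mult_def sum_distrib_left sum_distrib_right mult_ac)
  also have "\<dots> = bilinear_dot v (transpose A *v w)"
    by (subst sum.swap) (simp add: bilinear_dot_def matrix_vector_mult_def transpose_def sum_distrib_left)
  finally show ?thesis .
qed

definition quad :: "complex^'n^'n::finite \<Rightarrow> real^'n \<Rightarrow> complex" where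
  "quad A x = bilinear_dot (cvec x) (A *v cvec x)"

lemma quad_sum: "quad A x = (\<Sum>i\<in>UNIV. \<Sum>j\<in>UNIV. A $ i $ j * x $ i * x $ j)"
  by (simp add: quad_def bilinear_dot_def matrix_vector_mult_def cvec_def sum_distrib_left mult_ac)

section \<open>Degree-2 polynomials as symmetric quadratic forms\<close>

lemma multi_index_Suc:
  fixes \<alpha> :: "'n::finite \<Rightarrow> nat"
  assumes "sum \<alpha> UNIV = Suc d"
  shows "\<exists>i \<beta>. sum \<beta> UNIV = d \<and>
    (\<forall>y :: 'n \<Rightarrow> 'a::comm_semiring_1. (\<Prod>j\<in>UNIV. y j ^ \<alpha> j) = y i * (\<Prod>j\<in>UNIV. y j ^ \<beta> j))"
proof -
  obtain i m where i: "\<alpha> i = Suc m"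
    using assms by (metis nat.distinct(1) not0_implies_Suc sum.neutral)
  define \<beta> where "\<beta> = \<alpha>(i := m)"
  have "sum \<beta> (UNIV - {i}) = sum \<alpha> (UNIV - {i})"
    by (rule sum.cong) (auto simp: \<beta>_def)
  then have "sum \<beta> UNIV = d"
    using assms sum.remove[of UNIV i \<alpha>] sum.remove[of UNIV i \<beta>] by (simp add: i \<beta>_def)
  moreover have "(\<Prod>j\<in>UNIV. y j ^ \<alpha> j) = y i * (\<Prod>j\<in>UNIV. y j ^ \<beta> j)" for y :: "'n \<Rightarrow> 'a"
  proof -
    have "(\<Prod>j\<in>UNIV-{i}. y j ^ \<beta> j) = (\<Prod>j\<in>UNIV-{i}. y j ^ \<alpha> j)"
      by (rule prod.cong) (auto simp: \<beta>_def)
    then show ?thesis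
      using prod.remove[of UNIV i "\<lambda>j. y j ^ \<alpha> j"] prod.remove[of UNIV i "\<lambda>j. y j ^ \<beta> j"]
      by (simp add: i \<beta>_def mult.assoc)
  qed
  ultimately show ?thesis by blast
qed

text \<open>Splitting off one variable twice leaves the empty monomial. The pair is chosen before
  \<open>y\<close>, so it depends on \<alpha> only and can serve as a matrix position.\<close>

lemma monomial_degree_2:
  fixes \<alpha> :: "'n::finite \<Rightarrow> nat"
  assumes "sum \<alpha> UNIV = 2"
  shows "\<exists>p. \<forall>y :: 'n \<Rightarrow> 'a::comm_semiring_1. (\<Prod>j\<in>UNIV. y j ^ \<alpha> j) = y (fst p) * y (snd p)"
proof -
  obtain i \<beta> where \<beta>: "sum \<beta> UNIV = Suc 0"
    "\<And>y :: 'n \<Rightarrow> 'a. (\<Prod>j\<in>UNIV. y j ^ \<alpha> j) = y i * (\<Prod>j\<in>UNIV. y j ^ \<beta> j)"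
    using multi_index_Suc[of \<alpha> "Suc 0"] assms by (auto simp: numeral_2_eq_2)
  obtain k \<gamma> where \<gamma>: "sum \<gamma> UNIV = 0"
    "\<And>y :: 'n \<Rightarrow> 'a. (\<Prod>j\<in>UNIV. y j ^ \<beta> j) = y k * (\<Prod>j\<in>UNIV. y j ^ \<gamma> j)"
    using multi_index_Suc[OF \<beta>(1)] by blast
  have "\<gamma> j = 0" for j using \<gamma>(1) by simp
  then show ?thesis using \<beta>(2) \<gamma>(2) by (intro exI[of _ "(i, k)"]) simp
qed

lemma homogeneous_poly_2_quad:
  fixes F :: "real^'n::finite \<Rightarrow> complex"
  assumes "homogeneous_poly 2 F"
  obtains A where "transpose A = A" "F = quad A"
proof -
  let ?S = "{\<alpha> :: 'n \<Rightarrow> nat. (\<Sum>i\<in>UNIV. \<alpha> i) = 2}"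
  obtain c where c: "\<And>x. F x = (\<Sum>\<alpha>\<in>?S. c \<alpha> * (\<Prod>i\<in>UNIV. complex_of_real (x $ i) ^ \<alpha> i))"
    using assms unfolding homogeneous_poly_def by blast
  have "\<forall>\<alpha>\<in>?S. \<exists>p. \<forall>y :: 'n \<Rightarrow> complex. (\<Prod>j\<in>UNIV. y j ^ \<alpha> j) = y (fst p) * y (snd p)"
    using monomial_degree_2 by blast
  then obtain p where p: "\<And>\<alpha> (y :: 'n \<Rightarrow> complex). \<alpha> \<in> ?S \<Longrightarrow>
      (\<Prod>j\<in>UNIV. y j ^ \<alpha> j) = y (fst (p \<alpha>)) * y (snd (p \<alpha>))"
    by metis
  \<comment> \<open>Each coefficient \<open>c \<alpha>\<close> goes to the single entry
    \<open>p \<alpha>\<close>; the resulting matrix is in general not symmetric.\<close>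
  define M :: "complex^'n^'n" where "M = (\<chi> i j. \<Sum>\<alpha>\<in>?S. if p \<alpha> = (i, j) then c \<alpha> else 0)"
  have FM: "F x = (\<Sum>i\<in>UNIV. \<Sum>j\<in>UNIV. M $ i $ j * x $ i * x $ j)" for x
  proof -
    have "F x = (\<Sum>\<alpha>\<in>?S. c \<alpha> * (x $ fst (p \<alpha>) * x $ snd (p \<alpha>)))"
      unfolding c by (rule sum.cong) (simp_all add: p)
    also have "\<dots> = (\<Sum>\<alpha>\<in>?S. \<Sum>q\<in>UNIV. if p \<alpha> = q then c \<alpha> * x $ fst q * x $ snd q else 0)"
      by (simp add: sum.delta mult.assoc)
    also have "\<dots> = (\<Sum>q\<in>UNIV. \<Sum>\<alpha>\<in>?S. if p \<alpha> = q then c \<alpha> * x $ fst q * x $ snd q else 0)"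
      by (rule sum.swap)
    also have "\<dots> = (\<Sum>q\<in>UNIV. M $ fst q $ snd q * x $ fst q * x $ snd q)"
      by (auto simp: M_def sum_distrib_right intro!: sum.cong)
    also have "\<dots> = (\<Sum>i\<in>UNIV. \<Sum>j\<in>UNIV. M $ i $ j * x $ i * x $ j)"
      unfolding sum.cartesian_product by (simp add: case_prod_beta)
    finally show ?thesis .
  qed
  \<comment> \<open>Averaging with the transpose makes the matrix symmetric and leaves the quadratic
    form unchanged.\<close>
  define A where "A = (\<chi> i j. (M $ i $ j + M $ j $ i) / 2)"
  have "transpose A = A"
    by (simp add: A_def transpose_def vec_eq_iff add.commute)
  moreover have "F x = quad A x" for x
  proof -
    have "(\<Sum>i\<in>UNIV. \<Sum>j\<in>UNIV. M $ j $ i * x $ i * x $ j) = F x"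
      unfolding FM by (subst sum.swap) (simp add: mult_ac)
    moreover have "quad A x = ((\<Sum>i\<in>UNIV. \<Sum>j\<in>UNIV. M $ i $ j * x $ i * x $ j)
        + (\<Sum>i\<in>UNIV. \<Sum>j\<in>UNIV. M $ j $ i * x $ i * x $ j)) / 2"
      by (simp add: quad_sum A_def sum.distrib[symmetric] sum_divide_distrib field_simps)
    ultimately show ?thesis using FM[of x] by simp
  qed
  ultimately show ?thesis using that by blast
qed

section \<open>Gradients of quadratic forms and anticommutation\<close>

lemma partial_deriv_quadratic:
  fixes a :: "real^'n::finite^'n"
  shows "partial_deriv k (\<lambda>x. \<Sum>i\<in>UNIV. \<Sum>j\<in>UNIV. a $ i $ j * x $ i * x $ j) x
    = (\<Sum>j\<in>UNIV. (a $ k $ j + a $ j $ k) * x $ j)"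
proof -
  have nth: "((\<lambda>x. x $ i) has_derivative (\<lambda>h. h $ i)) (at x)" for i
    by (intro bounded_linear_imp_has_derivative bounded_linear_vec_nth)
  have "((\<lambda>x. a $ i $ j * x $ i * x $ j) has_derivative
      (\<lambda>h. a $ i $ j * (h $ i * x $ j + x $ i * h $ j))) (at x)" for i j
    using has_derivative_mult_right[OF has_derivative_mult[OF nth[of i] nth[of j]], of "a $ i $ j"]
    by (simp add: mult.assoc add.commute)
  then have "((\<lambda>x. \<Sum>i\<in>UNIV. \<Sum>j\<in>UNIV. a $ i $ j * x $ i * x $ j) has_derivative
      (\<lambda>h. \<Sum>i\<in>UNIV. \<Sum>j\<in>UNIV. a $ i $ j * (h $ i * x $ j + x $ i * h $ j))) (at x)"
    by (intro has_derivative_sum)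
  then have "partial_deriv k (\<lambda>x. \<Sum>i\<in>UNIV. \<Sum>j\<in>UNIV. a $ i $ j * x $ i * x $ j) x
      = (\<Sum>i\<in>UNIV. \<Sum>j\<in>UNIV. a $ i $ j * (axis k 1 $ i * x $ j + x $ i * axis k 1 $ j))"
    unfolding partial_deriv_def by (simp add: frechet_derivative_at[symmetric])
  also have "\<dots> = (\<Sum>i\<in>UNIV. \<Sum>j\<in>UNIV. if i = k then a $ i $ j * x $ j else 0)
      + (\<Sum>i\<in>UNIV. \<Sum>j\<in>UNIV. if j = k then a $ i $ j * x $ i else 0)"
    unfolding sum.distrib[symmetric] by (intro sum.cong refl) (auto simp: axis_def algebra_simps)
  also have "(\<Sum>i\<in>UNIV. \<Sum>j\<in>UNIV. if i = k then a $ i $ j * x $ j else 0) = (\<Sum>j\<in>UNIV. a $ k $ j * x $ j)"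
    by (subst sum.swap) simp
  also have "(\<Sum>i\<in>UNIV. \<Sum>j\<in>UNIV. if j = k then a $ i $ j * x $ i else 0) = (\<Sum>j\<in>UNIV. a $ j $ k * x $ j)"
    by simp
  finally show ?thesis by (simp add: sum.distrib distrib_right)
qed

text \<open>The real and imaginary parts of \<open>quad A\<close> are real quadratic forms with
  matrices Re A and Im A, so the real derivative formula applies to each; symmetry of
  \<open>A\<close> merges its two terms into the factor 2.\<close>

lemma cgradient_quad:
  fixes A :: "complex^'n::finite^'n"
  assumes "transpose A = A"
  shows "cgradient (quad A) x = 2 *s (A *v cvec x)"
proof -
  have sym: "A $ i $ j = A $ j $ i" for i j
    using assms by (metis transpose_def vec_lambda_beta)
  have "(\<lambda>y. Re (quad A y)) = (\<lambda>y. \<Sum>i\<in>UNIV. \<Sum>j\<in>UNIV. (\<chi> i j. Re (A $ i $ j)) $ i $ j * y $ i * y $ j)"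
    by (simp add: quad_sum)
  then have re: "partial_deriv k (\<lambda>y. Re (quad A y)) x = (\<Sum>j\<in>UNIV. 2 * Re (A $ k $ j) * x $ j)" for k
    by (simp only: partial_deriv_quadratic) (simp add: sym[of _ k])
  have "(\<lambda>y. Im (quad A y)) = (\<lambda>y. \<Sum>i\<in>UNIV. \<Sum>j\<in>UNIV. (\<chi> i j. Im (A $ i $ j)) $ i $ j * y $ i * y $ j)"
    by (simp add: quad_sum)
  then have im: "partial_deriv k (\<lambda>y. Im (quad A y)) x = (\<Sum>j\<in>UNIV. 2 * Im (A $ k $ j) * x $ j)" for k
    by (simp only: partial_deriv_quadratic) (simp add: sym[of _ k])
  show ?thesis
    by (simp add: vec_eq_iff cgradient_def gradient_def re im matrix_vector_mult_def cvec_def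
        complex_eq_iff sum_distrib_left mult.assoc)
qed

text \<open>Polarization: although \<open>quad\<close> sees real vectors only, the real coordinate
  vectors and their pairwise sums already recover all entries of \<open>A\<close>.\<close>

lemma quad_eq_0_imp:
  fixes A :: "complex^'n::finite^'n"
  assumes sym: "transpose A = A" and 0: "\<And>x. quad A x = 0"
  shows "A = 0"
proof -
  have axis: "bilinear_dot (cvec (axis i 1)) (A *v cvec (axis j 1)) = A $ i $ j" for i j
  proof -
    have "cvec (axis k 1) = (axis k 1 :: complex^'n)" for k
      by (simp add: cvec_def axis_def vec_eq_iff)
    then show ?thesis
      by (simp add: bilinear_dot_def axis_def matrix_vector_mult_def if_distrib if_distribR cong: if_cong)
  qed
  have "A $ i $ j = 0" for i j
  proof -
    let ?i = "axis i 1 :: real^'n" and ?j = "axis j 1 :: real^'n"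
    have "0 = quad A (?i + ?j) - quad A ?i - quad A ?j"
      by (simp add: 0)
    also have "\<dots> = A $ i $ j + A $ j $ i"
      by (simp add: quad_def cvec_add bilinear_dot_add_left bilinear_dot_add_right
          matrix_vector_right_distrib axis)
    also have "A $ j $ i = A $ i $ j"
      using sym by (metis transpose_def vec_lambda_beta)
    finally show ?thesis by simp
  qed
  then show ?thesis by (simp add: vec_eq_iff)
qed

text \<open>By symmetry, the product of \<open>A x\<close> and \<open>B x\<close> equals both x^T A
  B x and x^T B A x. Hence the form of the symmetric matrix AB + BA vanishes on all real vectors,
  and so does the matrix.\<close>

lemma gradient_orthogonal_imp_anticommute:
  fixes A B :: "complex^'n::finite^'n"
  assumes A: "transpose A = A" and B: "transpose B = B"
    and orth: "\<And>x. bilinear_dot (cgradient (quad A) x) (cgradient (quad B) x) = 0"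
  shows "A ** B + B ** A = 0"
proof (rule quad_eq_0_imp)
  have tadd: "transpose (M + N) = transpose M + transpose N" for M N :: "complex^'n^'n"
    by (simp add: transpose_def vec_eq_iff)
  show "transpose (A ** B + B ** A) = A ** B + B ** A"
    by (simp add: tadd matrix_transpose_mul A B add.commute)
  fix x
  have AB: "bilinear_dot (A *v cvec x) (B *v cvec x) = 0"
    using orth[of x]
    by (simp add: cgradient_quad A B bilinear_dot_scale_left bilinear_dot_scale_right)
  then have BA: "bilinear_dot (B *v cvec x) (A *v cvec x) = 0"
    by (simp add: bilinear_dot_commute)
  show "quad (A ** B + B ** A) x = 0"
    using AB BA
    by (simp add: quad_def matrix_vector_mult_add_rdistrib bilinear_dot_add_right
        bilinear_dot_matrix A B matrix_vector_mul_assoc)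
qed

section \<open>Anticommuting symmetric matrices\<close>

text \<open>The exact signs depend on the number of factors in a product; only vanishing is of
  interest later, so they are not tracked.\<close>

definition eq_pm :: "'a::group_add \<Rightarrow> 'a \<Rightarrow> bool" where
  "eq_pm M N \<longleftrightarrow> M = N \<or> M = - N"

lemma eq_pm_trans: "eq_pm L M \<Longrightarrow> eq_pm M N \<Longrightarrow> eq_pm L N"
  by (auto simp: eq_pm_def)

lemma matrix_mult_minus_left: "(- A) ** B = - (A ** B)" for A :: "'a::ring_1^'n^'m"
  by (simp add: matrix_matrix_mult_def vec_eq_iff sum_negf)

lemma matrix_mult_minus_right: "A ** (- B) = - (A ** B)" for A :: "'a::ring_1^'n^'m"
  by (simp add: matrix_matrix_mult_def vec_eq_iff sum_negf)

lemma eq_pm_mult_left: "eq_pm M N \<Longrightarrow> eq_pm (A ** M) (A ** N)" for A :: "'a::ring_1^'n^'m"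
  by (auto simp: eq_pm_def matrix_mult_minus_right)

lemma eq_pm_mult_right: "eq_pm M N \<Longrightarrow> eq_pm (M ** A) (N ** A)" for A :: "'a::ring_1^'n^'m"
  by (auto simp: eq_pm_def matrix_mult_minus_left)

text \<open>The product \<open>P\<close> is built greedily: a new matrix \<open>C\<close> is put in
  front exactly when \<open>C ** P\<close> is nonzero. The second conjunct records that
  \<open>P\<close> is the empty product or has a leftmost factor in \<open>\<B>\<close>. Commutation
  up to sign is kept for all of \<open>\<A>\<close>, so that it covers factors still to
  come.\<close>

lemma anticommuting_annihilator:
  fixes \<A> :: "(complex^'n::finite^'n) set"
  assumes sym: "\<And>A. A \<in> \<A> \<Longrightarrow> transpose A = A"
    and anti: "\<And>A B. A \<in> \<A> \<Longrightarrow> B \<in> \<A> \<Longrightarrow> A ** B + B ** A = 0"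
    and "finite \<B>" "\<B> \<subseteq> \<A>"
  shows "\<exists>P. P \<noteq> 0 \<and> (P = mat 1 \<or> (\<exists>A\<in>\<B>. \<exists>Q. P = A ** Q)) \<and> eq_pm (transpose P) P
    \<and> (\<forall>A\<in>\<A>. eq_pm (P ** A) (A ** P)) \<and> (\<forall>A\<in>\<B>. A ** P = 0)"
  using assms(3,4)
proof (induction rule: finite_induct)
  case empty
  have "(mat 1 :: complex^'n^'n) \<noteq> 0"
    by (metis matrix_vector_mul_lid matrix_vector_mult_0 zero_neq_one one_index zero_index)
  then show ?case by (intro exI[of _ "mat 1"]) (simp add: eq_pm_def)
next
  case (insert C \<B>)
  then obtain P where P: "P \<noteq> 0" "P = mat 1 \<or> (\<exists>A\<in>\<B>. \<exists>Q. P = A ** Q)" "eq_pm (transpose P) P"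
    "\<And>A. A \<in> \<A> \<Longrightarrow> eq_pm (P ** A) (A ** P)" "\<And>A. A \<in> \<B> \<Longrightarrow> A ** P = 0"
    by blast
  have C: "C \<in> \<A>" using insert by simp
  have swap: "A ** C = - (C ** A)" if "A \<in> \<A>" for A
    using anti[OF that C] by (simp add: eq_neg_iff_add_eq_0)
  show ?case
  proof (cases "C ** P = 0")
    case True
    with P show ?thesis by blast
  next
    case False
    have "C ** C = 0"
    proof -
      have "(C ** C) + (C ** C) = 0" using anti[OF C C] .
      then show ?thesis by (simp add: vec_eq_iff flip: mult_2)
    qed
    \<comment> \<open>(CP)^T = P^T C, which is P C up to sign, hence C P up to sign.\<close>
    have "eq_pm (transpose (C ** P)) (C ** P)"
    proof -
      have "eq_pm (transpose P ** C) (P ** C)" using P(3) by (rule eq_pm_mult_right)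
      then show ?thesis
        using P(4)[OF C] by (simp add: matrix_transpose_mul sym[OF C] eq_pm_trans)
    qed
    moreover have "eq_pm ((C ** P) ** A) (A ** (C ** P))" if "A \<in> \<A>" for A
    proof -
      have "eq_pm (C ** (P ** A)) (C ** (A ** P))"
        by (rule eq_pm_mult_left) (rule P(4)[OF that])
      moreover have "eq_pm ((C ** A) ** P) ((A ** C) ** P)"
        by (rule eq_pm_mult_right) (simp add: swap[OF that] eq_pm_def)
      ultimately show ?thesis
        by (simp add: matrix_mul_assoc eq_pm_trans)
    qed
    \<comment> \<open>\<open>C\<close> kills the new product because C^2 = 0; any other
      \<open>A\<close> moves past \<open>C\<close> with a sign and then kills
      \<open>P\<close>.\<close>
    moreover have "A ** (C ** P) = 0" if "A \<in> insert C \<B>" for A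
    proof (cases "A = C")
      case True
      then show ?thesis using \<open>C ** C = 0\<close> by (simp add: matrix_mul_assoc)
    next
      case False
      with that insert.prems have "A \<in> \<B>" "A \<in> \<A>" by auto
      have "A ** (C ** P) = - (C ** (A ** P))"
        by (simp add: matrix_mul_assoc swap[OF \<open>A \<in> \<A>\<close>] matrix_mult_minus_left)
      then show ?thesis by (simp add: P(5)[OF \<open>A \<in> \<B>\<close>])
    qed
    ultimately show ?thesis using False by blast
  qed
qed

lemma common_isotropic_kernel_vector:
  fixes \<A> :: "(complex^'n::finite^'n) set"
  assumes sym: "\<And>A. A \<in> \<A> \<Longrightarrow> transpose A = A"
    and anti: "\<And>A B. A \<in> \<A> \<Longrightarrow> B \<in> \<A> \<Longrightarrow> A ** B + B ** A = 0"
    and nz: "\<not> \<A> \<subseteq> {0}"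
  obtains w where "w \<noteq> 0" "bilinear_dot w w = 0" "\<And>A. A \<in> \<A> \<Longrightarrow> A *v w = 0"
proof -
  \<comment> \<open>\<open>\<A>\<close> may be infinite. A real basis of its span inside
    \<open>\<A>\<close> is finite, and annihilating \<open>P\<close> is a linear condition, so
    treating the basis suffices.\<close>
  obtain \<B> where \<B>: "\<B> \<subseteq> \<A>" "independent \<B>" "\<A> \<subseteq> span \<B>"
    using maximal_independent_subset by blast
  obtain P where P: "P \<noteq> 0" "P = mat 1 \<or> (\<exists>A\<in>\<B>. \<exists>Q. P = A ** Q)" "eq_pm (transpose P) P"
    "\<And>A. A \<in> \<A> \<Longrightarrow> eq_pm (P ** A) (A ** P)" "\<And>A. A \<in> \<B> \<Longrightarrow> A ** P = 0"
    using anticommuting_annihilator[of \<A> \<B>] sym anti independent_imp_finite[OF \<B>(2)] \<B>(1) by blast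
  have "subspace {A. A ** P = 0}"
    by (auto simp: subspace_def matrix_matrix_mult_def vec_eq_iff distrib_right sum.distrib)
       (metis scaleR_sum_right scaleR_zero_right)
  then have "span \<B> \<subseteq> {A. A ** P = 0}"
    using P(5) by (intro span_minimal) auto
  with \<B>(3) have AP: "A ** P = 0" if "A \<in> \<A>" for A using that by blast
  obtain A\<^sub>0 where "A\<^sub>0 \<in> \<A>" "A\<^sub>0 \<noteq> 0" using nz by blast
  \<comment> \<open>A nonzero matrix annihilates \<open>P\<close>, so \<open>P\<close> is not the
    identity and has a leftmost factor \<open>A\<close> in the family. Then P A = 0 up to sign, and
    P P = (P A) Q = 0.\<close>
  then have "P \<noteq> mat 1" using AP[of A\<^sub>0] by auto
  then obtain A Q where AQ: "A \<in> \<A>" "P = A ** Q"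
    using P(2) \<B>(1) by blast
  have "P ** A = 0"
    using P(4)[OF AQ(1)] AP[OF AQ(1)] by (simp add: eq_pm_def)
  then have "P ** P = 0"
    using matrix_mul_assoc[of P A Q] by (simp flip: AQ(2))
  then have PP: "transpose P ** P = 0"
    using P(3) by (auto simp: eq_pm_def matrix_mult_minus_left)
  obtain u where u: "P *v u \<noteq> 0"
    using P(1) by (metis matrix_eq matrix_vector_mult_0)
  show ?thesis
  proof
    show "P *v u \<noteq> 0" by (rule u)
    \<comment> \<open>Moving one \<open>P\<close> across the product gives u^T (P^T P) u.\<close>
    show "bilinear_dot (P *v u) (P *v u) = 0"
      by (simp add: bilinear_dot_matrix matrix_vector_mul_assoc PP) (simp add: bilinear_dot_def)
    show "A *v (P *v u) = 0" if "A \<in> \<A>" for A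
      by (simp add: matrix_vector_mul_assoc AP[OF that])
  qed
qed

text \<open>For w = p + iq the real and imaginary parts of w^T w are |p|^2 - |q|^2 and 2<p,q>. Their
  vanishing makes p and q orthogonal of equal length, and \<open>r\<close> is that length.\<close>

lemma isotropic_vector_orthonormal_frame:
  fixes w :: "complex^'n::finite"
  assumes "w \<noteq> 0" "bilinear_dot w w = 0"
  obtains r a b where "r \<noteq> 0" "norm a = 1" "norm b = 1" "inner a b = 0"
    "w = r *s (cvec a + \<i> *s cvec b)"
proof -
  define p where "p = (\<chi> i. Re (w $ i))"
  define q where "q = (\<chi> i. Im (w $ i))"
  have w: "w = cvec p + \<i> *s cvec q"
    by (simp add: vec_eq_iff cvec_def p_def q_def complex_eq_iff)
  have "bilinear_dot w w = Complex (inner p p - inner q q) (2 * inner p q)"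
    by (simp add: w bilinear_dot_def cvec_def inner_vec_def complex_eq_iff sum_subtractf sum.distrib
        sum_distrib_left algebra_simps)
  with assms(2) have eq: "inner p p = inner q q" "inner p q = 0"
    by (simp_all add: complex_eq_iff)
  have "norm p = norm q" using eq(1) by (simp add: norm_eq_sqrt_inner)
  moreover have "norm p \<noteq> 0"
  proof
    assume "norm p = 0"
    then have "p = 0" "q = 0" using \<open>norm p = norm q\<close> by auto
    then show False using assms(1) by (simp add: w cvec_def vec_eq_iff)
  qed
  ultimately show ?thesis
    using eq(2)
    by (intro that[of "complex_of_real (norm p)" "p /\<^sub>R norm p" "q /\<^sub>R norm p"])
       (simp_all add: w vec_eq_iff cvec_def field_simps)
qed

section \<open>Axes of holomorphy\<close>

text \<open>The degenerate case k = 0: zero functions factor through the one-point space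
  C^0.\<close>

lemma uniform_axis_UNIV:
  fixes \<F> :: "(real^'n::finite \<Rightarrow> complex) set"
  assumes "\<And>F x. F \<in> \<F> \<Longrightarrow> F x = 0"
  shows "uniform_axis_of_holomorphy UNIV \<F>"
proof -
  let ?\<pi> = "\<lambda>v :: real^'n. (\<lambda>i :: nat. 0 :: complex)"
  \<comment> \<open>Empty when \<open>\<F>\<close> is empty, since the two families of functions
    must agree exactly.\<close>
  let ?\<G> = "{g :: (nat \<Rightarrow> complex) \<Rightarrow> complex. g = (\<lambda>z. 0) \<and> \<F> \<noteq> {}}"
  have "orthogonal_projection 0 UNIV ?\<pi>"
    unfolding orthogonal_projection_def isometric_embedding_def
    by (auto simp: cspace_def cspace_inner_def cspace_norm_def intro!: exI[of _ "\<lambda>z. 0"])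
  moreover have "\<forall>g\<in>?\<G>. holomorphic_cspace 0 g"
    by (auto simp: holomorphic_cspace_def cspace_norm_def intro: exI[of _ "1 :: real"])
  moreover have "{(\<lambda>v\<in>UNIV. F (x + v)) | x F. F \<in> \<F>} = {(\<lambda>v\<in>UNIV. g (?\<pi> v)) | g. g \<in> ?\<G>}"
    (is "?L = ?R")
  proof -
    have eq: "(\<lambda>v\<in>UNIV. F (x + v)) = (\<lambda>v\<in>UNIV. 0)" if "F \<in> \<F>" for F x
      using assms[OF that] by (simp add: restrict_def)
    then have "?L \<subseteq> ?R" by fastforce
    moreover have "?R \<subseteq> ?L" using eq[symmetric] by blast
    ultimately show ?thesis by blast
  qed
  ultimately have "uniformly_complex_type UNIV {(\<lambda>v\<in>UNIV. F (x + v)) | x F. F \<in> \<F>}"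
    unfolding uniformly_complex_type_def
    by (intro exI[of _ 0] exI[of _ ?\<pi>] exI[of _ ?\<G>] conjI)
  then show ?thesis
    by (simp add: uniform_axis_of_holomorphy_def)
qed

lemma holomorphic_cspace_quadratic:
  "holomorphic_cspace (Suc 0) (\<lambda>z. \<alpha> + \<beta> * z 0 + \<gamma> * (z 0)\<^sup>2)"
  unfolding holomorphic_cspace_def
proof (intro ballI)
  fix z :: "nat \<Rightarrow> complex"
  have "\<exists>d>0. \<forall>w\<in>cspace (Suc 0). cspace_norm (Suc 0) (\<lambda>i. w i - z i) < d \<longrightarrow>
      cmod ((\<alpha> + \<beta> * w 0 + \<gamma> * (w 0)\<^sup>2) - (\<alpha> + \<beta> * z 0 + \<gamma> * (z 0)\<^sup>2)
        - (\<Sum>i<Suc 0. (\<beta> + 2 * \<gamma> * z 0) * (w i - z i)))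
      \<le> e * cspace_norm (Suc 0) (\<lambda>i. w i - z i)" if "e > 0" for e
  \<comment> \<open>The remainder is \<gamma> (w 0 - z 0)^2, which is to be at most e |w 0 - z 0| in
    modulus; the summand 1 avoids division by zero when \<gamma> = 0.\<close>
  proof (intro exI[of _ "e / (cmod \<gamma> + 1)"] conjI ballI impI)
    have pos: "cmod \<gamma> + 1 > 0" by (simp add: add_nonneg_pos)
    then show "e / (cmod \<gamma> + 1) > 0" using that by simp
    fix w assume "cspace_norm (Suc 0) (\<lambda>i. w i - z i) < e / (cmod \<gamma> + 1)"
    then have "cmod (w 0 - z 0) * (cmod \<gamma> + 1) \<le> e"
      using pos by (simp add: cspace_norm_def L2_set_def field_simps)
    moreover have "cmod (w 0 - z 0) * cmod \<gamma> \<le> cmod (w 0 - z 0) * (cmod \<gamma> + 1)"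
      by (simp add: mult_left_mono)
    ultimately have "(cmod \<gamma> * cmod (w 0 - z 0)) * cmod (w 0 - z 0) \<le> e * cmod (w 0 - z 0)"
      by (intro mult_right_mono) (auto simp: mult.commute)
    moreover have "(\<alpha> + \<beta> * w 0 + \<gamma> * (w 0)\<^sup>2) - (\<alpha> + \<beta> * z 0 + \<gamma> * (z 0)\<^sup>2)
        - (\<beta> + 2 * \<gamma> * z 0) * (w 0 - z 0) = \<gamma> * (w 0 - z 0) * (w 0 - z 0)"
      by (simp add: power2_eq_square algebra_simps)
    ultimately show "cmod ((\<alpha> + \<beta> * w 0 + \<gamma> * (w 0)\<^sup>2) - (\<alpha> + \<beta> * z 0 + \<gamma> * (z 0)\<^sup>2)
        - (\<Sum>i<Suc 0. (\<beta> + 2 * \<gamma> * z 0) * (w i - z i)))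
      \<le> e * cspace_norm (Suc 0) (\<lambda>i. w i - z i)"
      by (simp add: cspace_norm_def L2_set_def norm_mult)
  qed
  then show "\<exists>a. \<forall>e>0. \<exists>d>0. \<forall>w\<in>cspace (Suc 0). cspace_norm (Suc 0) (\<lambda>i. w i - z i) < d \<longrightarrow>
      cmod ((\<alpha> + \<beta> * w 0 + \<gamma> * (w 0)\<^sup>2) - (\<alpha> + \<beta> * z 0 + \<gamma> * (z 0)\<^sup>2)
        - (\<Sum>i<Suc 0. a i * (w i - z i)))
      \<le> e * cspace_norm (Suc 0) (\<lambda>i. w i - z i)"
    by (intro exI[of _ "\<lambda>i. \<beta> + 2 * \<gamma> * z 0"]) blast
qed

lemma orthogonal_projection_plane:
  fixes a b :: "'a::euclidean_space"
  assumes "norm a = 1" "norm b = 1" "inner a b = 0"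
  shows "orthogonal_projection (Suc 0) (span {a, b})
    (\<lambda>v i. if i = 0 then Complex (inner v a) (inner v b) else 0)"
proof -
  \<comment> \<open>The isometry sending 1 to \<open>a\<close> and \<i> to \<open>b\<close>; its
    adjoint reads off the two inner products.\<close>
  let ?\<iota> = "\<lambda>z :: nat \<Rightarrow> complex. Re (z 0) *\<^sub>R a + Im (z 0) *\<^sub>R b"
  have ab: "inner a a = 1" "inner b b = 1" "inner b a = 0"
    using assms by (auto simp: norm_eq_1 inner_commute)
  have "isometric_embedding (Suc 0) (span {a, b}) ?\<iota>"
    unfolding isometric_embedding_def
  proof (intro conjI ballI allI)
    fix z :: "nat \<Rightarrow> complex"
    show "?\<iota> z \<in> span {a, b}" by (intro span_add span_scale span_base) auto
    show "norm (?\<iota> z) = cspace_norm (Suc 0) z"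
      by (simp add: cspace_norm_def L2_set_def norm_eq_sqrt_inner inner_add_left inner_add_right
          ab assms(3) inner_complex_def
          flip: dot_square_norm)
  qed (simp_all add: algebra_simps)
  then show ?thesis
    unfolding orthogonal_projection_def
    by (auto simp: cspace_def cspace_inner_def inner_complex_def inner_add_right mult.commute
        intro!: exI[of _ ?\<iota>])
qed

text \<open>The kernel condition says A b = i A a, so \<open>A\<close> maps s a + t b to (s + it) A
  a. The expansion of the form thus involves s and t only through s + it.\<close>

lemma quad_on_isotropic_plane:
  fixes A :: "complex^'n::finite^'n"
  assumes sym: "transpose A = A" and ker: "A *v (cvec a + \<i> *s cvec b) = 0"
  shows "quad A (x + (s *\<^sub>R a + t *\<^sub>R b)) = quad A x
    + 2 * bilinear_dot (cvec x) (A *v cvec a) * Complex s t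
    + bilinear_dot (cvec a) (A *v cvec a) * (Complex s t)\<^sup>2"
proof -
  let ?v = "cvec (s *\<^sub>R a + t *\<^sub>R b)" and ?z = "Complex s t"
  have "A *v cvec a + \<i> *s (A *v cvec b) = 0"
    using ker by (simp add: matrix_vector_right_distrib vector_scalar_commute)
  then have "A *v cvec b = \<i> *s (A *v cvec a)"
    by (simp add: vec_eq_iff complex_eq_iff add_eq_0_iff)
  then have Av: "A *v ?v = ?z *s (A *v cvec a)"
    by (simp add: cvec_add cvec_scaleR matrix_vector_right_distrib vector_scalar_commute vec_eq_iff
        Complex_eq algebra_simps)
  have swap: "bilinear_dot u (A *v v) = bilinear_dot v (A *v u)" for u v
    by (metis bilinear_dot_commute bilinear_dot_matrix sym)
  \<comment> \<open>Symmetry of \<open>A\<close> moves it onto \<open>?v\<close>, where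
    \<open>Av\<close> applies; this yields the second factor of the square.\<close>
  have "bilinear_dot ?v (A *v cvec a) = ?z * bilinear_dot (cvec a) (A *v cvec a)"
    by (simp add: swap[of ?v] Av bilinear_dot_scale_right)
  then show ?thesis
    unfolding quad_def
    by (simp add: cvec_add[of x] bilinear_dot_add_left bilinear_dot_add_right matrix_vector_right_distrib
        swap[of ?v "cvec x"] Av bilinear_dot_scale_right power2_eq_square
        distrib_left mult_ac)
qed

text \<open>The base point \<open>x\<close> and the matrix \<open>A\<close> enter only the
  coefficients of the holomorphic polynomial, while the projection depends on \<open>a\<close> and
  \<open>b\<close> alone. This is what makes the axis uniform.\<close>

lemma uniform_axis_isotropic_plane:
  fixes \<A> :: "(complex^'n::finite^'n) set"
  assumes ab: "norm a = 1" "norm b = 1" "inner a b = 0"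
    and sym: "\<And>A. A \<in> \<A> \<Longrightarrow> transpose A = A"
    and ker: "\<And>A. A \<in> \<A> \<Longrightarrow> A *v (cvec a + \<i> *s cvec b) = 0"
  shows "uniform_axis_of_holomorphy (span {a, b}) (quad ` \<A>)"
proof -
  let ?\<pi> = "\<lambda>v i. if i = (0 :: nat) then Complex (inner v a) (inner v b) else 0"
  let ?V = "span {a, b}"
  define G :: "real^'n \<Rightarrow> complex^'n^'n \<Rightarrow> (nat \<Rightarrow> complex) \<Rightarrow> complex" where
    "G = (\<lambda>x A z. quad A x + 2 * bilinear_dot (cvec x) (A *v cvec a) * z 0
      + bilinear_dot (cvec a) (A *v cvec a) * (z 0)\<^sup>2)"
  have GF: "(\<lambda>v\<in>?V. quad A (x + v)) = (\<lambda>v\<in>?V. G x A (?\<pi> v))" if "A \<in> \<A>" for x A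
  proof (rule restrict_ext)
    fix v assume "v \<in> ?V"
    then obtain s t where v: "v = s *\<^sub>R a + t *\<^sub>R b"
      by (metis (no_types) span_breakdown_eq span_empty singletonD diff_eq_eq add.commute add_0
          right_minus_eq)
    have "inner v a = s" "inner v b = t"
      using ab by (simp_all add: v inner_add_left inner_commute[of b a] norm_eq_1)
    then show "quad A (x + v) = G x A (?\<pi> v)"
      using quad_on_isotropic_plane[OF sym[OF that] ker[OF that]] by (simp add: G_def v)
  qed
  have "\<forall>g\<in>{G x A | x A. A \<in> \<A>}. holomorphic_cspace (Suc 0) g"
    by (auto simp: G_def holomorphic_cspace_quadratic)
  moreover have "{(\<lambda>v\<in>?V. F (x + v)) | x F. F \<in> quad ` \<A>}
      = {(\<lambda>v\<in>?V. g (?\<pi> v)) | g. g \<in> {G x A | x A. A \<in> \<A>}}"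
    (is "?L = ?R")
  proof
    show "?L \<subseteq> ?R" using GF by blast
    show "?R \<subseteq> ?L" using GF[symmetric] by blast
  qed
  ultimately show ?thesis
    unfolding uniform_axis_of_holomorphy_def uniformly_complex_type_def
    using orthogonal_projection_plane[OF ab] subspace_span by blast
qed

theorem theorem6:
  fixes \<F> :: "(real^'n::finite \<Rightarrow> complex) set"
  assumes "eigenfamily \<F>"
    and "\<forall>F\<in>\<F>. homogeneous_poly 2 F \<and> harmonic_morphism F"
  shows "\<exists>V. uniform_axis_of_holomorphy V \<F> \<and> dim V \<ge> min 2 CARD('n)"
proof -
  define \<A> where "\<A> = {A :: complex^'n^'n. transpose A = A \<and> quad A \<in> \<F>}"
  have sym: "transpose A = A" if "A \<in> \<A>" for A using that by (simp add: \<A>_def)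
  have \<F>: "\<F> = quad ` \<A>"
  proof
    show "quad ` \<A> \<subseteq> \<F>" by (auto simp: \<A>_def)
    show "\<F> \<subseteq> quad ` \<A>"
    proof
      fix F assume "F \<in> \<F>"
      then obtain A where "transpose A = A" "F = quad A"
        using assms(2) homogeneous_poly_2_quad by metis
      with \<open>F \<in> \<F>\<close> show "F \<in> quad ` \<A>" by (auto simp: \<A>_def)
    qed
  qed
  show ?thesis
  \<comment> \<open>If no matrix is nonzero, the whole space is an axis, of dimension CARD('n);
    otherwise the isotropic plane has dimension 2. Either value is at least the minimum.\<close>
  proof (cases "\<A> \<subseteq> {0}")
    case True
    then have "uniform_axis_of_holomorphy UNIV \<F>"
      by (intro uniform_axis_UNIV) (auto simp: \<F> quad_sum)
    then show ?thesis by (intro exI[of _ UNIV]) (simp add: dim_UNIV)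
  next
    case False
    have anti: "A ** B + B ** A = 0" if "A \<in> \<A>" "B \<in> \<A>" for A B
      using that assms(1)
      by (intro gradient_orthogonal_imp_anticommute) (auto simp: \<A>_def eigenfamily_def)
    obtain w where w: "w \<noteq> 0" "bilinear_dot w w = 0" "\<And>A. A \<in> \<A> \<Longrightarrow> A *v w = 0"
      using common_isotropic_kernel_vector[OF sym anti False] by blast
    obtain r a b where ab: "r \<noteq> 0" "norm a = 1" "norm b = 1" "inner a b = 0"
      and wab: "w = r *s (cvec a + \<i> *s cvec b)"
      using isotropic_vector_orthonormal_frame[OF w(1,2)] by metis
    \<comment> \<open>The nonzero scalar \<open>r\<close> cancels.\<close>
    have "A *v (cvec a + \<i> *s cvec b) = 0" if "A \<in> \<A>" for A
      using w(3)[OF that] ab(1) unfolding wab vector_scalar_commute by (simp only: vector_mul_eq_0 simp_thms)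
    then have "uniform_axis_of_holomorphy (span {a, b}) \<F>"
      unfolding \<F> using uniform_axis_isotropic_plane[OF ab(2-4)] sym by blast
    moreover have "dim (span {a, b}) = 2"
    proof -
      have "a \<noteq> b" using ab by auto
      moreover have "independent {a, b}"
        using ab by (intro pairwise_orthogonal_independent)
          (auto simp: pairwise_def orthogonal_def inner_commute)
      ultimately show ?thesis using dim_eq_card_independent[of "{a, b}"] by simp
    qed
    ultimately show ?thesis by (intro exI[of _ "span {a, b}"]) simp
  qed
qed

end
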